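(* Let $P$ be a set of $n$ points in the plane $\mathbb{R}^2$ whose weighted unit-distance graph $G = (P, E)$ is connected, and let $\varepsilon \in (0,1)$. Then the construction described in the context results in a $\tfrac{1}{\varepsilon}$-WSPD of $P$ with respect to the shortest-path metric $d_G$ of $G$, of size $O(\varepsilon^{-2} n \log n)$ (with an absolute constant in the $O$).
   Context: Weighted unit-distance graph: the graph $G=(P,E)$ in which two distinct points $x,y\in P$ are joined by an edge iff $\|x-y\|\le 1$, the edge having weight $\|x-y\|$. $d_G(x,y)$ is the length of a shortest path between $x$ and $y$ in $G$. For a metric $d$ on $P$ and $X,Y\subseteq P$ write $\mathrm{diam}_d(X) = \max_{x,y\in X} d(x,y)$ and $d(X,Y)=\min_{x\in X,y\in Y} d(x,y)$. A pair decomposition of $P$ is a set of pairs $\{\{A_1,B_1\},\ldots,\{A_s,B_s\}\}$ with $A_i, B_i\subset P$, $A_i\cap B_i=\emptyset$, such that every unordered pair of distinct points of $P$ has one point in $A_i$ and the other in $B_i$ for some $i$ (possibly several). Its size is $s$. For $t>0$, a $t$-WSPD of $P$ with respect to $d$ is a pair decomposition in which every pair satisfies $\max(\mathrm{diam}_d(A_i),\mathrm{diam}_d(B_i)) \le \tfrac1t d(A_i,B_i)$. It is a known theorem (Callahan and Kosaraju) that for the Euclidean metric, every set of $n$ points in $\mathbb{R}^D$ ($D$ constant) and every $\varepsilon\in(0,1]$ admit a $\tfrac1\varepsilon$-WSPD of size $O(n/\varepsilon^D)$. An $r$-packing of $G$ is a set $N\subseteq P$ such that every $p\in P$ has $\min_{z\in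 N} d_G(p,z)<r$ and every two distinct $x,y\in N$ have $d_G(x,y)\ge r$. For $p\in N$, the Voronoi cell $P_N(p)$ is the set of all $q\in P$ whose nearest neighbor in $N$ under $d_G$ is $p$ (each $q$ is assigned a single nearest neighbor, ties being broken arbitrarily). Construction. (Short distances) Compute a $\tfrac{64}{\varepsilon}$-WSPD of $P$ for the Euclidean metric, of size $O(n/\varepsilon^2)$, by the Callahan–Kosaraju theorem, and throw away every pair $\{A,B\}$ in which $A$ or $B$ has Euclidean diameter $>1$; let $\mathcal{W}_1$ be the set of remaining pairs. ($i$th resolution) For $i = 2,\ldots,2+\lceil\log_2 n\rceil$, let $r_i = 3\cdot 2^i$, let $N_i$ be an $(r_i/2)$-packing of $G$, and let $$\mathcal{W}_i = \bigl\{ \{P_{N_i}(x),P_{N_i}(y)\} : x,y\in N_i,\ d_G(x,y)\in[2r_i/\varepsilon,\,16r_i/\varepsilon]\bigr\}.$$ The output is $\mathcal{W}=\bigcup_{i\ge 1}\mathcal{W}_i$. *)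

theory Defs
  imports "HOL-Analysis.Analysis" "Graph_Theory.Shortest_Path" "Graph_Theory.Pair_Digraph"
    "Graph_Theory.Digraph_Component"
begin

text \<open>The undirected edge {x, y} is represented by the two arcs (x, y) and (y, x).\<close>

definition udg :: "(real^2) set \<Rightarrow> (real^2) pair_pre_digraph" where
  "udg P = \<lparr> pverts = P, parcs = {(x, y). x \<in> P \<and> y \<in> P \<and> x \<noteq> y \<and> norm (x - y) \<le> 1} \<rparr>"

definition udg_weight :: "(real^2) \<times> (real^2) \<Rightarrow> real" where
  "udg_weight e = norm (fst e - snd e)"

lemma wf_digraph_udg: "wf_digraph (with_proj (udg P))"
  by unfold_locales (auto simp: udg_def)

lemma symmetric_udg: "symmetric (with_proj (udg P))"
  by (auto simp: symmetric_def udg_def norm_minus_commute intro!: symI)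

text \<open>The library's shortest-path distance is an extended real, infinite exactly between
  points in different components; the real part is used for connected graphs only.\<close>

definition udg_dist :: "(real^2) set \<Rightarrow> real^2 \<Rightarrow> real^2 \<Rightarrow> real" where
  "udg_dist P x y = real_of_ereal (wf_digraph.\<mu> (with_proj (udg P)) udg_weight x y)"

text \<open>The next two notions are meaningful for finite nonempty sets only; a pair decomposition
  of a finite set consists of such sets.\<close>

definition diam_wrt :: "('a \<Rightarrow> 'a \<Rightarrow> real) \<Rightarrow> 'a set \<Rightarrow> real" where
  "diam_wrt d X = Max {d x y | x y. x \<in> X \<and> y \<in> X}"

definition setdist_wrt :: "('a \<Rightarrow> 'a \<Rightarrow> real) \<Rightarrow> 'a set \<Rightarrow> 'a set \<Rightarrow> real" where
  "setdist_wrt d X Y = Min {d x y | x y. x \<in> X \<and> y \<in> Y}"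

text \<open>Pairs are unordered: an element of W is a doubleton {A, B}, so that the size is card W.\<close>

definition pair_decomposition :: "'a set \<Rightarrow> 'a set set set \<Rightarrow> bool" where
  "pair_decomposition P W \<longleftrightarrow>
     (\<forall>e\<in>W. \<exists>A B. e = {A, B} \<and> A \<subseteq> P \<and> B \<subseteq> P \<and> A \<noteq> {} \<and> B \<noteq> {} \<and> A \<inter> B = {}) \<and>
     (\<forall>x\<in>P. \<forall>y\<in>P. x \<noteq> y \<longrightarrow> (\<exists>A B. {A, B} \<in> W \<and> x \<in> A \<and> y \<in> B))"

definition wspd :: "('a \<Rightarrow> 'a \<Rightarrow> real) \<Rightarrow> real \<Rightarrow> 'a set \<Rightarrow> 'a set set set \<Rightarrow> bool" where
  "wspd d t P W \<longleftrightarrow> pair_decomposition P W \<and>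
     (\<forall>A B. {A, B} \<in> W \<longrightarrow> max (diam_wrt d A) (diam_wrt d B) \<le> 1 / t * setdist_wrt d A B)"

definition packing :: "('a \<Rightarrow> 'a \<Rightarrow> real) \<Rightarrow> real \<Rightarrow> 'a set \<Rightarrow> 'a set \<Rightarrow> bool" where
  "packing d r P N \<longleftrightarrow> N \<subseteq> P \<and> (\<forall>p\<in>P. \<exists>z\<in>N. d p z < r) \<and>
     (\<forall>x\<in>N. \<forall>y\<in>N. x \<noteq> y \<longrightarrow> r \<le> d x y)"

text \<open>c assigns to every point of P one of its nearest neighbours in N, so it fixes how ties
  are broken.\<close>

definition nearest_assignment ::
    "('a \<Rightarrow> 'a \<Rightarrow> real) \<Rightarrow> 'a set \<Rightarrow> 'a set \<Rightarrow> ('a \<Rightarrow> 'a) \<Rightarrow> bool" where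
  "nearest_assignment d P N c \<longleftrightarrow> (\<forall>q\<in>P. is_arg_min (d q) (\<lambda>z. z \<in> N) (c q))"

definition voronoi_cell :: "'a set \<Rightarrow> ('a \<Rightarrow> 'a) \<Rightarrow> 'a \<Rightarrow> 'a set" where
  "voronoi_cell P c p = {q \<in> P. c q = p}"

definition short_pairs :: "(real^2) set set set \<Rightarrow> (real^2) set set set" where
  "short_pairs W0 = {e \<in> W0. \<forall>A\<in>e. diam_wrt dist A \<le> 1}"

definition resolution :: "nat \<Rightarrow> real" where
  "resolution i = 3 * 2 ^ i"

definition levels :: "(real^2) set \<Rightarrow> nat set" where
  "levels P = {2..2 + nat \<lceil>log 2 (real (card P))\<rceil>}"

definition level_pairs ::
    "(real^2) set \<Rightarrow> real \<Rightarrow> real \<Rightarrow> (real^2) set \<Rightarrow> (real^2 \<Rightarrow> real^2) \<Rightarrow> (real^2) set set set" where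
  "level_pairs P \<epsilon> r N c = {{voronoi_cell P c x, voronoi_cell P c y} | x y.
     x \<in> N \<and> y \<in> N \<and> udg_dist P x y \<in> {2 * r / \<epsilon> .. 16 * r / \<epsilon>}}"

text \<open>W is a possible output of the construction on P and \<epsilon>, for some choice of the Euclidean
  well-separated pair decomposition W0, the packings N i and the tie-breaking c i. The parameter
  K is the constant in the size bound on W0 given by the theorem of Callahan and Kosaraju.\<close>

definition construction_output ::
    "real \<Rightarrow> (real^2) set \<Rightarrow> real \<Rightarrow> (real^2) set set set \<Rightarrow> bool" where
  "construction_output K P \<epsilon> W \<longleftrightarrow> (\<exists>W0 N c.
     wspd dist (64 / \<epsilon>) P W0 \<and>
     real (card W0) \<le> K * real (card P) / \<epsilon>\<^sup>2 \<and>
     (\<forall>i\<in>levels P. packing (udg_dist P) (resolution i / 2) P (N i) \<and>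
        nearest_assignment (udg_dist P) P (N i) (c i)) \<and>
     W = short_pairs W0 \<union> (\<Union>i\<in>levels P. level_pairs P \<epsilon> (resolution i) (N i) (c i)))"

end

(* A pair of W_1 consists of two cliques of G, on which d_G is the Euclidean metric, so its
   Euclidean separation carries over. The cells of N_i have radius below r_i/2, and the two cells
   of a pair of W_i have centres at distance at least 2 r_i/eps. Conversely, a pair of points
   whose Euclidean pair was thrown away is at distance at least 64/eps, and every distance in
   [36/eps, n] lies in some [3 r_i/eps, 15 r_i/eps], which leaves room for moving both points to
   their centres.

   For the size, write r = 12 M. Every x in N_i has, by connectivity, M points at graph distance
   about 0, 2, ..., 2(M-1), and all these points, taken over all x in N_i, are at Euclidean distance
   more than 1 from each other. Hence |N_i| M <= n, and since a disk of radius 17 r/eps contains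
   only O((r/eps)^2) such points, x has only O(r^2/(eps^2 M)) partners. As M is proportional to r,
   there are O(n/eps^2) pairs on each of the O(log n) levels. *)

theory Submission
  imports Defs
begin

section \<open>Separated points in a disk\<close>

text \<open>Doubling the coordinates and rounding down places the points into grid squares of side
  1/2. Two points in one square are less than 1 apart, so a square holds at most one of them. The
  bounding square of the disk meets at most \<open>4 * R + 2\<close> columns and as many
  rows.\<close>

lemma card_separated_subset_cball:
  fixes S :: "(real^2) set"
  assumes sub: "S \<subseteq> cball x R"
    and sep: "\<And>a b. a \<in> S \<Longrightarrow> b \<in> S \<Longrightarrow> a \<noteq> b \<Longrightarrow> 1 < dist a b"
  shows "real (card S) \<le> (4 * R + 2)\<^sup>2"
proof (cases "S = {}")
  case False
  then have R: "0 \<le> R"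
    using sub by (metis cball_eq_empty not_less subset_empty)
  define g where "g p = (\<lfloor>2 * p$1\<rfloor>, \<lfloor>2 * p$2\<rfloor>)" for p :: "real^2"
  define I where "I k = {\<lfloor>2 * (x$k - R)\<rfloor>..\<lfloor>2 * (x$k + R)\<rfloor>}" for k :: 2
  have "inj_on g S"
  proof (rule inj_onI, rule ccontr)
    fix a b assume ab: "a \<in> S" "b \<in> S" "g a = g b" "a \<noteq> b"
    then have "\<bar>a$1 - b$1\<bar> < 1/2" "\<bar>a$2 - b$2\<bar> < 1/2"
      unfolding g_def prod.inject by linarith+
    then have "dist a b < 1"
      using norm_le_l1_cart[of "a - b"] by (simp add: dist_norm sum_2)
    then show False using sep ab by fastforce
  qed
  moreover have "g ` S \<subseteq> I 1 \<times> I 2"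
  proof (rule image_subsetI)
    fix p assume "p \<in> S"
    then have "norm (x - p) \<le> R"
      using sub by (auto simp: dist_norm)
    then have "\<bar>x$k - p$k\<bar> \<le> R" for k
      using component_le_norm_cart[of "x - p" k] by simp
    then have "x$k - R \<le> p$k" "p$k \<le> x$k + R" for k
      by (smt (verit))+
    then have "\<lfloor>2 * p$k\<rfloor> \<in> I k" for k
      unfolding I_def by (auto intro!: floor_mono mult_left_mono simp del: distrib_left_numeral right_diff_distrib_numeral)
    then show "g p \<in> I 1 \<times> I 2"
      by (simp add: g_def)
  qed
  ultimately have "card S \<le> card (I 1 \<times> I 2)"
    by (rule card_inj_on_le) (simp add: I_def)
  then have "real (card S) \<le> real (card (I 1)) * real (card (I 2))"
    by (simp add: card_cartesian_product flip: of_nat_mult)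
  also have "real (card (I k)) \<le> 4 * R + 2" for k
    using R unfolding I_def by simp linarith
  then have "real (card (I 1)) * real (card (I 2)) \<le> (4 * R + 2)\<^sup>2"
    unfolding power2_eq_square using R by (intro mult_mono) auto
  finally show ?thesis .
qed simp

section \<open>Diameters, set distances and pair decompositions\<close>

lemma finite_values: "finite X \<Longrightarrow> finite Y \<Longrightarrow> finite {d x y | x y. x \<in> X \<and> y \<in> Y}"
  using finite_image_set2[of "\<lambda>x. x \<in> X" "\<lambda>y. y \<in> Y" d] by simp

text \<open>The definition provides just one way of writing the doubleton. The five properties
  together are symmetric in the two sets, so they hold for either order.\<close>

lemma pair_decompositionD:
  assumes "pair_decomposition P W" "{A, B} \<in> W"
  shows "A \<subseteq> P" "B \<subseteq> P" "A \<noteq> {}" "B \<noteq> {}" "A \<inter> B = {}"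
  using assms unfolding pair_decomposition_def by (metis doubleton_eq_iff Int_commute)+

lemma diam_wrt_le:
  assumes "finite X" "X \<noteq> {}" "\<And>x y. x \<in> X \<Longrightarrow> y \<in> X \<Longrightarrow> d x y \<le> D"
  shows "diam_wrt d X \<le> D"
proof -
  have "diam_wrt d X \<in> {d x y | x y. x \<in> X \<and> y \<in> X}"
    unfolding diam_wrt_def using assms(1,2) by (intro Max_in finite_values) auto
  then show ?thesis
    using assms(3) by auto
qed

lemma le_diam_wrt: "finite X \<Longrightarrow> x \<in> X \<Longrightarrow> y \<in> X \<Longrightarrow> d x y \<le> diam_wrt d X"
  unfolding diam_wrt_def by (intro Max_ge finite_values) auto

lemma setdist_wrt_le: "finite X \<Longrightarrow> finite Y \<Longrightarrow> x \<in> X \<Longrightarrow> y \<in> Y \<Longrightarrow> setdist_wrt d X Y \<le> d x y"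
  unfolding setdist_wrt_def by (intro Min_le finite_values) auto

lemma setdist_wrt_attained:
  assumes "finite X" "finite Y" "X \<noteq> {}" "Y \<noteq> {}"
  obtains x y where "x \<in> X" "y \<in> Y" "setdist_wrt d X Y = d x y"
proof -
  have "setdist_wrt d X Y \<in> {d x y | x y. x \<in> X \<and> y \<in> Y}"
    unfolding setdist_wrt_def using assms by (intro Min_in finite_values) auto
  then show ?thesis using that by blast
qed

text \<open>Replaces \<open>Max\<close> and \<open>Min\<close> by pointwise inequalities. Bounding
  the diameter of the first set suffices: the pairs are unordered and \<open>d\<close> is symmetric,
  so the other diameter follows by exchanging \<open>A\<close> and \<open>B\<close>.\<close>

lemma wspdI:
  assumes P: "finite P" and W: "pair_decomposition P W"
    and sym: "\<And>x y. x \<in> P \<Longrightarrow> y \<in> P \<Longrightarrow> d x y = d y x"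
    and sep: "\<And>A B a a' x y. {A, B} \<in> W \<Longrightarrow> a \<in> A \<Longrightarrow> a' \<in> A \<Longrightarrow> x \<in> A \<Longrightarrow> y \<in> B
      \<Longrightarrow> d a a' \<le> 1 / t * d x y"
  shows "wspd d t P W"
  unfolding wspd_def
proof (intro conjI W allI impI)
  fix A B assume AB: "{A, B} \<in> W"
  note p = pair_decompositionD[OF W AB]
  have fin: "finite A" "finite B"
    using p P by (auto intro: finite_subset)
  obtain x y where xy: "x \<in> A" "y \<in> B" "setdist_wrt d A B = d x y"
    using setdist_wrt_attained[of A B d] fin p by auto
  then have "d x y = d y x"
    using p by (intro sym) auto
  moreover have "{B, A} \<in> W"
    using AB by (simp add: insert_commute)
  ultimately have "diam_wrt d A \<le> 1 / t * d x y" "diam_wrt d B \<le> 1 / t * d x y"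
    using xy p fin AB sep[of A B] sep[of B A] by (metis diam_wrt_le)+
  then show "max (diam_wrt d A) (diam_wrt d B) \<le> 1 / t * setdist_wrt d A B"
    using xy by simp
qed

lemma wspdD:
  assumes P: "finite P" and W: "wspd d t P W" and t: "0 < t" and AB: "{A, B} \<in> W"
    and xy: "x \<in> A" "y \<in> B"
  shows "diam_wrt d A \<le> 1 / t * d x y" "diam_wrt d B \<le> 1 / t * d x y"
proof -
  have pd: "pair_decomposition P W"
    using W by (simp add: wspd_def)
  have "finite A" "finite B"
    using pair_decompositionD[OF pd AB] P by (auto intro: finite_subset)
  then have "1 / t * setdist_wrt d A B \<le> 1 / t * d x y"
    using t xy by (intro mult_left_mono setdist_wrt_le) auto
  moreover have "max (diam_wrt d A) (diam_wrt d B) \<le> 1 / t * setdist_wrt d A B"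
    using W AB by (simp add: wspd_def)
  ultimately show "diam_wrt d A \<le> 1 / t * d x y" "diam_wrt d B \<le> 1 / t * d x y"
    by auto
qed

section \<open>The shortest-path metric of a connected unit-distance graph\<close>

locale connected_udg =
  fixes P :: "(real^2) set"
  assumes finite_P: "finite P"
    and conn: "Digraph_Component.connected (with_proj (udg P))"
begin

sublocale G: pair_pseudo_graph "udg P"
proof -
  have "pverts (udg P) = P" "parcs (udg P) \<subseteq> P \<times> P"
    by (auto simp: udg_def)
  then show "pair_pseudo_graph (udg P)"
    using finite_P symmetric_udg[of P] by unfold_locales (auto intro: finite_subset)
qed

lemma in_parcs_iff: "e \<in> parcs (udg P) \<longleftrightarrow>
    fst e \<in> P \<and> snd e \<in> P \<and> fst e \<noteq> snd e \<and> dist (fst e) (snd e) \<le> 1"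
  by (auto simp: udg_def dist_norm)

lemma pverts_udg [simp]: "pverts (udg P) = P"
  by (simp add: udg_def)

lemma udg_weight_eq_dist: "udg_weight e = dist (fst e) (snd e)"
  by (simp add: udg_weight_def dist_norm)

lemma reachable: "x \<in> P \<Longrightarrow> y \<in> P \<Longrightarrow> x \<rightarrow>\<^sup>*\<^bsub>with_proj (udg P)\<^esub> y"
  using G.symmetric_connected_imp_strongly_connected[OF symmetric_udg conn]
  by (simp add: strongly_connected_def)

text \<open>Connectivity and nonnegative weights make the infimum over walks a minimum attained by a
  simple path. It is therefore finite, and \<open>real_of_ereal\<close> loses nothing.\<close>

lemma udg_dist_attained:
  assumes "x \<in> P" "y \<in> P"
  obtains p where "G.apath x p y" "G.\<mu> udg_weight x y = ereal (G.awalk_cost udg_weight p)"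
    "udg_dist P x y = G.awalk_cost udg_weight p"
  using G.min_cost_awalk[OF reachable[OF assms], of udg_weight]
  by (auto simp: udg_weight_eq_dist udg_dist_def)

lemma udg_dist_le_cost:
  assumes "G.awalk x p y"
  shows "udg_dist P x y \<le> G.awalk_cost udg_weight p"
proof -
  have "x \<in> P" "y \<in> P"
    using G.awalk_hd_in_verts[OF assms] G.awalk_last_in_verts[OF assms] by auto
  then have "G.\<mu> udg_weight x y = ereal (udg_dist P x y)"
    by (rule udg_dist_attained) simp
  then show ?thesis
    using G.min_cost_le_walk_cost[OF assms, of udg_weight] by simp
qed

lemma dist_le_cost: "G.awalk x p y \<Longrightarrow> dist x y \<le> G.awalk_cost udg_weight p"
proof (induction p arbitrary: x)
  case (Cons e p)
  then have "fst e = x" "dist (snd e) y \<le> G.awalk_cost udg_weight p"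
    by (auto simp: G.awalk_Cons_iff)
  then show ?case
    using dist_triangle[of x y "snd e"] by (simp add: udg_weight_eq_dist[of e])
qed (simp add: G.awalk_Nil_iff)

lemma dist_le_udg_dist: "x \<in> P \<Longrightarrow> y \<in> P \<Longrightarrow> dist x y \<le> udg_dist P x y"
  using udg_dist_attained[of x y] dist_le_cost G.awalkI_apath by metis

lemma udg_dist_self [simp]: "x \<in> P \<Longrightarrow> udg_dist P x x = 0"
  using udg_dist_le_cost[of x "[]" x] dist_le_udg_dist[of x x] by (simp add: G.awalk_Nil_iff)

text \<open>The single arc is a walk of Euclidean length, and no walk is shorter than the straight
  segment. Hence the two metrics agree on cliques.\<close>

lemma udg_dist_eq_dist:
  assumes "x \<in> P" "y \<in> P" "dist x y \<le> 1"
  shows "udg_dist P x y = dist x y"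
proof (cases "x = y")
  case False
  then have "G.awalk x [(x, y)] y"
    using assms by (simp add: G.awalk_simps in_parcs_iff)
  from udg_dist_le_cost[OF this] show ?thesis
    using dist_le_udg_dist[OF assms(1,2)] by (simp add: udg_weight_eq_dist)
qed (use assms in simp)

lemma udg_dist_triangle:
  assumes "x \<in> P" "y \<in> P" "z \<in> P"
  shows "udg_dist P x z \<le> udg_dist P x y + udg_dist P y z"
proof -
  obtain p where p: "G.apath x p y" "udg_dist P x y = G.awalk_cost udg_weight p"
    using udg_dist_attained assms by metis
  obtain q where q: "G.apath y q z" "udg_dist P y z = G.awalk_cost udg_weight q"
    using udg_dist_attained assms by metis
  have "G.awalk x (p @ q) z"
    by (rule G.awalk_appendI[OF G.awalkI_apath[OF p(1)] G.awalkI_apath[OF q(1)]])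
  from udg_dist_le_cost[OF this] show ?thesis using p q by simp
qed

lemma cost_rev_path: "G.awalk_cost udg_weight (rev_path p) = G.awalk_cost udg_weight p"
  by (induction p) (auto simp: udg_weight_eq_dist dist_commute)

lemma udg_dist_sym:
  assumes "x \<in> P" "y \<in> P"
  shows "udg_dist P x y = udg_dist P y x"
proof -
  have "udg_dist P y x \<le> udg_dist P x y" if xy: "x \<in> P" "y \<in> P" for x y
  proof -
    obtain p where p: "G.apath x p y" "udg_dist P x y = G.awalk_cost udg_weight p"
      by (rule udg_dist_attained[OF xy])
    then have "G.awalk y (rev_path p) x"
      using G.awalk_rev_path G.awalkI_apath by blast
    from udg_dist_le_cost[OF this] show ?thesis using p by (simp add: cost_rev_path)
  qed
  then show ?thesis using assms by (meson antisym)
qed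

text \<open>A simple path has fewer than \<open>card P\<close> arcs, each of weight at most 1. This
  bound is what makes logarithmically many resolutions sufficient.\<close>

lemma udg_dist_le_card:
  assumes "x \<in> P" "y \<in> P"
  shows "udg_dist P x y \<le> real (card P)"
proof -
  obtain p where p: "G.apath x p y" "udg_dist P x y = G.awalk_cost udg_weight p"
    using udg_dist_attained assms by metis
  have "set p \<subseteq> parcs (udg P)"
    using p by (auto simp: G.apath_def)
  then have "G.awalk_cost udg_weight p \<le> real (length p)"
    by (induction p) (auto simp: in_parcs_iff udg_weight_eq_dist)
  also have "length p \<le> card P"
    using G.length_apath[OF p(1)] by simp
  finally show ?thesis using p by simp
qed

section \<open>Points at prescribed graph distances\<close>

lemma arc_across_cut: "G.awalk x p y \<Longrightarrow> x \<in> T \<Longrightarrow> y \<notin> T \<Longrightarrow>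
    \<exists>u v. (u, v) \<in> parcs (udg P) \<and> u \<in> T \<and> v \<notin> T"
proof (induction p arbitrary: x)
  case (Cons e p)
  then have "e \<in> parcs (udg P)" "fst e = x" "G.awalk (snd e) p y"
    by (auto simp: G.awalk_Cons_iff)
  with Cons show ?case by (cases e) (cases "snd e \<in> T"; auto)
qed (simp add: G.awalk_Nil_iff)

text \<open>A discrete intermediate value theorem: a walk to \<open>y\<close> must leave the set of
  points closer than \<open>t\<close> to \<open>x\<close>, and the arc on which it leaves overshoots
  \<open>t\<close> by less than 1.\<close>

lemma point_at_distance:
  assumes "x \<in> P" "y \<in> P" "0 \<le> t" "t \<le> udg_dist P x y"
  obtains z where "z \<in> P" "t \<le> udg_dist P x z" "udg_dist P x z < t + 1"
\<comment> \<open>For \<open>t = 0\<close> the set to be left would not contain \<open>x\<close>,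
  but then \<open>x\<close> itself is the required point.\<close>
proof (cases "t = 0")
  case True
  then show ?thesis using that[of x] assms by simp
next
  case False
  define T where "T = {u \<in> P. udg_dist P x u < t}"
  have "x \<in> T" "y \<notin> T"
    using False assms by (auto simp: T_def)
  moreover obtain p where "G.awalk x p y"
    using udg_dist_attained assms G.awalkI_apath by metis
  ultimately obtain u v where uv: "(u, v) \<in> parcs (udg P)" "u \<in> T" "v \<notin> T"
    using arc_across_cut by metis
  then have "u \<in> P" "v \<in> P" "udg_dist P u v \<le> 1"
    by (auto simp: in_parcs_iff udg_dist_eq_dist)
  moreover have "udg_dist P x u < t" "t \<le> udg_dist P x v"
    using uv \<open>v \<in> P\<close> by (auto simp: T_def)
  moreover have "udg_dist P x v \<le> udg_dist P x u + udg_dist P u v"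
    using \<open>u \<in> P\<close> \<open>v \<in> P\<close> \<open>x \<in> P\<close> by (intro udg_dist_triangle) 
  ultimately show ?thesis using that[of v] by linarith
qed

text \<open>Points of different layers around \<open>x\<close> have distances from \<open>x\<close> that differ by more
  than 1, so they are not adjacent and hence are at Euclidean distance more than 1.\<close>

lemma ex_layers:
  assumes "x \<in> P" "y \<in> P" "2 * real M \<le> udg_dist P x y"
  shows "\<exists>f. \<forall>j<M. f j \<in> P \<and> 2 * real j \<le> udg_dist P x (f j) \<and> udg_dist P x (f j) < 2 * real j + 1"
proof -
  have "\<exists>z. z \<in> P \<and> 2 * real j \<le> udg_dist P x z \<and> udg_dist P x z < 2 * real j + 1" if "j < M" for j
    using point_at_distance[OF assms(1,2), of "2 * real j"] that assms(3) by force
  then show ?thesis by metis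
qed

lemma one_less_dist:
  assumes "u \<in> P" "v \<in> P" "1 < udg_dist P u v"
  shows "1 < dist u v"
  using udg_dist_eq_dist[OF assms(1,2)] assms(3) by force

section \<open>Counting pairs of centres at one resolution\<close>

text \<open>With \<open>M\<close> layer points per centre, \<open>card N * M\<close> is at most
  \<open>card P\<close>, and the number of partners of one centre times \<open>M\<close> is at most
  \<open>(70 * (r / \<epsilon>))\<^sup>2\<close>. In the product of the two bounds the factor
  \<open>M * M\<close> cancels, since \<open>r\<close> is proportional to \<open>M\<close>.\<close>

lemma card_close_packing_pairs:
  fixes M :: nat
  assumes eps: "0 < \<epsilon>" "\<epsilon> < 1" and M: "1 \<le> M" and r: "r = 12 * real M"
    and N: "packing (udg_dist P) (r / 2) P N"
  shows "real (card {(x, y). x \<in> N \<and> y \<in> N \<and> udg_dist P x y \<in> {2 * r / \<epsilon> .. 16 * r / \<epsilon>}})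
    \<le> 705600 * (real (card P) / \<epsilon>\<^sup>2)" (is "real (card ?E) \<le> _")
\<comment> \<open>Layers around a centre exist because a second centre lies at distance at least
  \<open>6 * M\<close>. Without a second centre, the only possible distance is 0, below the
  window.\<close>
proof (cases "\<exists>x\<in>N. \<exists>y\<in>N. x \<noteq> y")
  case False
  have "?E = {}"
  proof -
    have "0 < 2 * r / \<epsilon>"
      using eps M r by simp
    moreover have "udg_dist P x y = 0" if "x \<in> N" "y \<in> N" for x y
    proof -
      have "x = y" "x \<in> P"
        using that False N by (auto simp: packing_def)
      then show ?thesis
        by simp
    qed
    ultimately show ?thesis
      by auto
  qed
  then show ?thesis
    by (simp only:) simp
next
  case True
  let ?d = "udg_dist P"
  have Nsep: "6 * real M \<le> ?d x y" if "x \<in> N" "y \<in> N" "x \<noteq> y" for x y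
    using N that by (auto simp: packing_def r)
  have NP: "N \<subseteq> P"
    using N by (simp add: packing_def)
  then have finN: "finite N"
    using finite_P finite_subset by blast
  have "\<exists>f. \<forall>j<M. f j \<in> P \<and> 2 * real j \<le> ?d x (f j) \<and> ?d x (f j) < 2 * real j + 1" if "x \<in> N" for x
  proof -
    obtain y where "y \<in> N" "y \<noteq> x"
      using True by metis
    then show ?thesis
      using that NP Nsep[of x y] by (intro ex_layers[of x y]) auto
  qed
  then obtain f where f: "\<And>x j. x \<in> N \<Longrightarrow> j < M \<Longrightarrow>
      f x j \<in> P \<and> 2 * real j \<le> ?d x (f x j) \<and> ?d x (f x j) < 2 * real j + 1"
    by metis
  define g where "g = (\<lambda>(x, j). f x j)"
  define L where "L Y = Y \<times> {..<M}" for Y :: "(real^2) set"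
  have L_mono: "L Y \<subseteq> L N" if "Y \<subseteq> N" for Y
    using that by (auto simp: L_def)
  have g_sep: "1 < dist (g a) (g b)" if ab: "a \<in> L N" "b \<in> L N" "a \<noteq> b" for a b
  proof -
    obtain x j y k where [simp]: "a = (x, j)" "b = (y, k)"
      by (cases a, cases b)
    have x: "x \<in> N" "j < M" "x \<in> P" "f x j \<in> P" and y: "y \<in> N" "k < M" "y \<in> P" "f y k \<in> P"
      using ab NP f by (auto simp: L_def)
    have tri: "?d x (f y k) \<le> ?d x (f x j) + ?d (f x j) (f y k)"
      "?d x y \<le> ?d x (f y k) + ?d y (f y k)"
      "?d y (f x j) \<le> ?d y (f y k) + ?d (f x j) (f y k)"
      using udg_dist_triangle[of x "f x j" "f y k"] udg_dist_triangle[of x "f y k" y]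
        udg_dist_triangle[of y "f y k" "f x j"] udg_dist_sym[of "f y k" y]
        udg_dist_sym[of "f y k" "f x j"] x y by simp_all
    have "1 < ?d (f x j) (f y k)"
    proof (cases "x = y")
      case False
      \<comment> \<open>Each layer point is within \<open>2 * M - 1\<close> of its own centre, so
        points of different centres are more than \<open>6 * M - 2 * (2 * M - 1) = 2 * M + 2\<close>
        apart.\<close>
      have "real j \<le> real M - 1" "real k \<le> real M - 1" "1 \<le> real M"
        using x(2) y(2) M by linarith+
      then show ?thesis
        using tri Nsep[OF x(1) y(1) False] f[OF x(1,2)] f[OF y(1,2)] by linarith
    next
      case True
      then have "j \<noteq> k"
        using ab by auto
      then have "real j + 1 \<le> real k \<or> real k + 1 \<le> real j"
        by linarith
      then show ?thesis
        using True tri f[OF x(1,2)] f[OF y(1,2)] by auto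
    qed
    then show ?thesis
      using one_less_dist x y by (simp add: g_def)
  qed
  have g_inj: "inj_on g (L N)"
    using g_sep by (fastforce simp: inj_on_def)
  have "card (L N) \<le> card P"
    using f by (intro card_inj_on_le[OF g_inj _ finite_P]) (auto simp: L_def g_def)
  then have N_le: "real (card N) * real M \<le> real (card P)"
    by (simp add: L_def card_cartesian_product flip: of_nat_mult)
  define Y where "Y x = {y \<in> N. ?d x y \<in> {2 * r / \<epsilon> .. 16 * r / \<epsilon>}}" for x
  have reps: "r \<le> r / \<epsilon>" "12 \<le> r"
    using eps M r by (simp_all add: field_simps)
  have Y_le: "real (card (Y x)) * real M \<le> (70 * (r / \<epsilon>))\<^sup>2" if "x \<in> N" for x
  proof -
    have "Y x \<subseteq> N"
      by (auto simp: Y_def)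
    note Y_L = L_mono[OF this]
    \<comment> \<open>The radius is 16 for reaching the partner \<open>y\<close>, plus 1 for going
      on from \<open>y\<close> to one of its layer points, in units of
      \<open>r / \<epsilon>\<close>.\<close>
    have "g ` L (Y x) \<subseteq> cball x (17 * (r / \<epsilon>))"
    proof (clarsimp simp: L_def g_def)
      fix y j assume y: "y \<in> Y x" and j: "j < M"
      then have yN: "y \<in> N" and xy: "?d x y \<le> 16 * (r / \<epsilon>)"
        by (auto simp: Y_def)
      have P: "x \<in> P" "y \<in> P" "f y j \<in> P"
        using that yN NP f j by auto
      have "?d y (f y j) \<le> r"
        using f[OF yN j] j r by linarith
      then have "?d x (f y j) \<le> 17 * (r / \<epsilon>)"
        using xy udg_dist_triangle[OF P] reps(1) by linarith
      then show "dist x (f y j) \<le> 17 * r / \<epsilon>"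
        using dist_le_udg_dist[OF P(1,3)] by simp
    qed
    then have "real (card (g ` L (Y x))) \<le> (4 * (17 * (r / \<epsilon>)) + 2)\<^sup>2"
      by (rule card_separated_subset_cball) (use g_sep Y_L in blast)
    \<comment> \<open>Here 70 is 4 * 17 + 2, the additive 2 being absorbed because
      \<open>r / \<epsilon>\<close> is at least 1.\<close>
    also have "\<dots> \<le> (70 * (r / \<epsilon>))\<^sup>2"
      using reps by (intro power_mono) auto
    also have "card (g ` L (Y x)) = card (Y x) * M"
      using inj_on_subset[OF g_inj Y_L] by (simp add: card_image L_def card_cartesian_product)
    finally show ?thesis
      by simp
  qed
  have "?E = Sigma N Y"
    by (auto simp: Y_def)
  moreover have "finite (Y x)" for x
    using finN by (simp add: Y_def)
  ultimately have "real (card ?E) = (\<Sum>x\<in>N. real (card (Y x)))"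
    using finN by (simp add: card_SigmaI)
  then have "real (card ?E) * real M = (\<Sum>x\<in>N. real (card (Y x)) * real M)"
    by (simp add: sum_distrib_right)
  also have "\<dots> \<le> real (card N) * (70 * (r / \<epsilon>))\<^sup>2"
    using Y_le by (intro sum_bounded_above)
  finally have "real (card ?E) * real M * real M \<le> real (card N) * (70 * (r / \<epsilon>))\<^sup>2 * real M"
    by (intro mult_right_mono) auto
  also have "\<dots> = (real (card N) * real M) * (70 * (r / \<epsilon>))\<^sup>2"
    by simp
  also have "\<dots> \<le> real (card P) * (70 * (r / \<epsilon>))\<^sup>2"
    by (intro mult_right_mono N_le) auto
  \<comment> \<open>The constant is 70 squared times 12 squared.\<close>
  also have "\<dots> = 705600 * (real (card P) / \<epsilon>\<^sup>2) * real M * real M"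
    by (simp add: r power2_eq_square)
  finally have "real (card ?E) * (real M * real M) \<le> 705600 * (real (card P) / \<epsilon>\<^sup>2) * (real M * real M)"
    by (simp only: mult.assoc)
  then show ?thesis
    using M by (subst (asm) mult_le_cancel_right_pos) auto
qed

text \<open>The pairs of cells are an image of the ordered pairs of centres just counted. From level
  2 on, the resolution is 12 times the natural number \<open>2 ^ (i - 2)\<close>, which serves as
  \<open>M\<close>.\<close>

lemma card_level_pairs:
  assumes "0 < \<epsilon>" "\<epsilon> < 1" "2 \<le> i" "packing (udg_dist P) (resolution i / 2) P N"
  shows "real (card (level_pairs P \<epsilon> (resolution i) N c)) \<le> 705600 * (real (card P) / \<epsilon>\<^sup>2)"
proof -
  let ?r = "resolution i"
  let ?E = "{(x, y). x \<in> N \<and> y \<in> N \<and> udg_dist P x y \<in> {2 * ?r / \<epsilon> .. 16 * ?r / \<epsilon>}}"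
  have eq: "level_pairs P \<epsilon> ?r N c = (\<lambda>(x, y). {voronoi_cell P c x, voronoi_cell P c y}) ` ?E"
    unfolding level_pairs_def by auto
  have "finite N"
    using assms(4) finite_P finite_subset by (auto simp: packing_def)
  then have fin: "finite ?E"
    by (auto intro: finite_subset[of _ "N \<times> N"])
  have "?r = 12 * real (2 ^ (i - 2))"
  proof -
    obtain k where "i = k + 2"
      using assms(3) by (metis add.commute le_Suc_ex)
    then show ?thesis
      by (simp add: resolution_def)
  qed
  then have "real (card ?E) \<le> 705600 * (real (card P) / \<epsilon>\<^sup>2)"
    using assms by (intro card_close_packing_pairs[of _ "2 ^ (i - 2)"]) auto
  moreover have "card (level_pairs P \<epsilon> ?r N c) \<le> card ?E"
    unfolding eq using fin by (rule card_image_le)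
  ultimately show "real (card (level_pairs P \<epsilon> ?r N c)) \<le> 705600 * (real (card P) / \<epsilon>\<^sup>2)"
    by linarith
qed

text \<open>Take the least level satisfying the upper bound. If it is above 2, failure one level
  below gives the lower bound, with 7.5 in place of 3; at level 2 the lower bound is
  \<open>36 / \<epsilon>\<close>. The top level qualifies since its resolution is at least
  \<open>card P\<close>. The factors 3 and 15 leave a margin inside the window from 2 to 16.\<close>

lemma level_of_distance:
  assumes eps: "0 < \<epsilon>" "\<epsilon> < 1" and xy: "x \<in> P" "y \<in> P" "64 / \<epsilon> \<le> udg_dist P x y"
  obtains i where "i \<in> levels P" "3 * (resolution i / \<epsilon>) \<le> udg_dist P x y"
    "udg_dist P x y \<le> 15 * (resolution i / \<epsilon>)"
proof -
  let ?D = "udg_dist P x y"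
  define Q where "Q i \<longleftrightarrow> 2 \<le> i \<and> ?D \<le> 15 * (resolution i / \<epsilon>)" for i
  define m where "m = 2 + nat \<lceil>log 2 (real (card P))\<rceil>"
  have card: "0 < card P"
    using xy finite_P card_gt_0_iff by blast
  have "Q m"
  proof -
    have "real (card P) = 2 powr log 2 (real (card P))"
      using card by simp
    also have "\<dots> \<le> 2 powr real m"
      unfolding m_def by (intro powr_mono) linarith+
    also have "\<dots> \<le> resolution m"
      by (simp add: powr_realpow resolution_def)
    also have "\<dots> \<le> resolution m / \<epsilon>"
      using eps by (simp add: resolution_def field_simps)
    finally show ?thesis
      using udg_dist_le_card[OF xy(1,2)] by (simp add: Q_def m_def)
  qed
  define i where "i = (LEAST i. Q i)"
  have "Q i" "i \<le> m"
    unfolding i_def using \<open>Q m\<close> by (auto intro: LeastI Least_le)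
  moreover have "3 * (resolution i / \<epsilon>) \<le> ?D"
  proof (cases "i = 2")
    case True
    then have "3 * (resolution i / \<epsilon>) = 36 / \<epsilon>"
      by (simp add: resolution_def)
    also have "\<dots> \<le> 64 / \<epsilon>"
      using eps by (simp add: divide_right_mono)
    finally show ?thesis
      using xy by simp
  next
    case False
    then obtain k where k: "i = Suc k" "2 \<le> k"
      using \<open>Q i\<close> unfolding Q_def by (cases i) auto
    then have "\<not> Q k"
      using not_less_Least[of k Q] i_def by simp
    then have "15 * (resolution k / \<epsilon>) < ?D"
      using k by (simp add: Q_def)
    moreover have "resolution i / \<epsilon> = 2 * (resolution k / \<epsilon>)"
      by (simp add: k resolution_def)
    moreover have "0 < resolution k / \<epsilon>"
      using eps by (simp add: resolution_def)
    ultimately show ?thesis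
      by linarith
  qed
  ultimately show ?thesis
    using that[of i] by (simp add: Q_def levels_def m_def)
qed

end

section \<open>Covering and separation for an output of the construction\<close>

locale udg_construction = connected_udg +
  fixes \<epsilon> :: real and W0 :: "(real^2) set set set" and N and c
  assumes eps: "0 < \<epsilon>" "\<epsilon> < 1"
    and W0: "wspd dist (64 / \<epsilon>) P W0"
    and packing: "\<And>i. i \<in> levels P \<Longrightarrow> packing (udg_dist P) (resolution i / 2) P (N i)"
    and nearest: "\<And>i. i \<in> levels P \<Longrightarrow> nearest_assignment (udg_dist P) P (N i) (c i)"
begin

definition pairs :: "(real^2) set set set" where
  "pairs = short_pairs W0 \<union> (\<Union>i\<in>levels P. level_pairs P \<epsilon> (resolution i) (N i) (c i))"

lemma resolution_le: "0 < resolution i" "resolution i \<le> resolution i / \<epsilon>"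
  using eps by (simp_all add: resolution_def field_simps)

lemma N_subset: "i \<in> levels P \<Longrightarrow> N i \<subseteq> P"
  using packing[of i] by (simp add: packing_def)

lemma nearest_in:
  assumes "i \<in> levels P" "q \<in> P"
  shows "c i q \<in> N i" "udg_dist P q (c i q) < resolution i / 2"
proof -
  have *: "is_arg_min (udg_dist P q) (\<lambda>z. z \<in> N i) (c i q)"
    using nearest assms by (simp add: nearest_assignment_def)
  then show "c i q \<in> N i"
    by (simp add: is_arg_min_def)
  have le: "\<And>z. z \<in> N i \<Longrightarrow> udg_dist P q (c i q) \<le> udg_dist P q z"
    using * by (simp add: is_arg_min_linorder)
  obtain z where z: "z \<in> N i" "udg_dist P q z < resolution i / 2"
    using packing[OF assms(1)] assms(2) by (auto simp: packing_def)
  then show "udg_dist P q (c i q) < resolution i / 2"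
    using le[OF z(1)] by linarith
qed

text \<open>Otherwise two distinct centres would be closer than the packing radius. It follows that
  the cells of centres are nonempty.\<close>

lemma center_in_cell:
  assumes "i \<in> levels P" "x \<in> N i"
  shows "c i x = x"
proof (rule ccontr)
  assume "c i x \<noteq> x"
  have x: "x \<in> P"
    using N_subset assms by auto
  have "resolution i / 2 \<le> udg_dist P x (c i x)"
    using packing[OF assms(1)] assms(2) \<open>c i x \<noteq> x\<close> nearest_in(1)[OF assms(1) x]
    by (auto simp: packing_def)
  then show False
    using nearest_in(2)[OF assms(1) x] by simp
qed

lemma W0_decomposition: "pair_decomposition P W0"
  using W0 by (simp add: wspd_def)

text \<open>Matching two doubletons may exchange the centres, which is why the distance bound is a
  disjunction; symmetry of the metric resolves it later.\<close>

lemma level_pairE: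
  assumes "{A, B} \<in> level_pairs P \<epsilon> (resolution i) (N i) (c i)"
  obtains x y where "A = voronoi_cell P (c i) x" "B = voronoi_cell P (c i) y"
    "x \<in> N i" "y \<in> N i" "2 * (resolution i / \<epsilon>) \<le> udg_dist P x y \<or> 2 * (resolution i / \<epsilon>) \<le> udg_dist P y x"
proof -
  obtain p q where pq: "{A, B} = {voronoi_cell P (c i) p, voronoi_cell P (c i) q}" "p \<in> N i" "q \<in> N i"
    "2 * (resolution i / \<epsilon>) \<le> udg_dist P p q"
    using assms unfolding level_pairs_def by auto
  then consider "A = voronoi_cell P (c i) p" "B = voronoi_cell P (c i) q"
    | "A = voronoi_cell P (c i) q" "B = voronoi_cell P (c i) p"
    by (auto simp only: doubleton_eq_iff)
  then show ?thesis
    using that[of p q] that[of q p] pq by cases auto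
qed

lemma pair_decomposition_pairs: "pair_decomposition P pairs"
  unfolding pair_decomposition_def
proof (intro conjI ballI impI)
  fix e assume "e \<in> pairs"
  then consider "e \<in> W0"
    | i x y where "i \<in> levels P" "e = {voronoi_cell P (c i) x, voronoi_cell P (c i) y}"
      "x \<in> N i" "y \<in> N i" "2 * resolution i / \<epsilon> \<le> udg_dist P x y"
    by (auto simp: pairs_def short_pairs_def level_pairs_def)
  then show "\<exists>A B. e = {A, B} \<and> A \<subseteq> P \<and> B \<subseteq> P \<and> A \<noteq> {} \<and> B \<noteq> {} \<and> A \<inter> B = {}"
  proof cases
    case 1
    then show ?thesis
      using W0_decomposition by (simp add: pair_decomposition_def)
  next
    case 2
    have P: "x \<in> P" "y \<in> P"
      using 2 N_subset by auto
    have "0 < 2 * resolution i / \<epsilon>"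
      using eps resolution_le(1)[of i] by simp
    then have "x \<noteq> y"
      using 2 P by auto
    moreover have "x \<in> voronoi_cell P (c i) x" "y \<in> voronoi_cell P (c i) y"
      using 2 P by (auto simp: voronoi_cell_def center_in_cell)
    moreover have "voronoi_cell P (c i) z \<subseteq> P" for z
      by (auto simp: voronoi_cell_def)
    moreover have "voronoi_cell P (c i) x \<inter> voronoi_cell P (c i) y = {}" if "x \<noteq> y"
      using that by (auto simp: voronoi_cell_def)
    ultimately show ?thesis
      using 2(2) by blast
  qed
next
  fix x y assume xy: "x \<in> P" "y \<in> P" "x \<noteq> y"
  then obtain A B where AB: "{A, B} \<in> W0" "x \<in> A" "y \<in> B"
    using W0_decomposition unfolding pair_decomposition_def by blast
  show "\<exists>A B. {A, B} \<in> pairs \<and> x \<in> A \<and> y \<in> B"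
  proof (cases "diam_wrt dist A \<le> 1 \<and> diam_wrt dist B \<le> 1")
    case True
    then have "{A, B} \<in> pairs"
      using AB by (simp add: pairs_def short_pairs_def)
    then show ?thesis
      using AB by blast
  next
    case False
    \<comment> \<open>The pair was discarded, so one of its diameters exceeds 1, and separation
      forces the two sets far apart.\<close>
    then have "1 \<le> 1 / (64 / \<epsilon>) * dist x y"
      using wspdD[OF finite_P W0 _ AB] eps by fastforce
    then have "64 / \<epsilon> \<le> dist x y"
      using eps by (simp add: field_simps)
    then have "64 / \<epsilon> \<le> udg_dist P x y"
      using dist_le_udg_dist[OF xy(1,2)] by linarith
    then obtain i where i: "i \<in> levels P" "3 * (resolution i / \<epsilon>) \<le> udg_dist P x y"
      "udg_dist P x y \<le> 15 * (resolution i / \<epsilon>)"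
      using level_of_distance[OF eps xy(1,2)] by metis
    let ?x = "c i x" and ?y = "c i y"
    note near = nearest_in[OF i(1) xy(1)] nearest_in[OF i(1) xy(2)]
    have P: "?x \<in> P" "?y \<in> P"
      using near N_subset[OF i(1)] by auto
    have "udg_dist P x y \<le> udg_dist P x ?x + udg_dist P ?x ?y + udg_dist P y ?y"
      "udg_dist P ?x ?y \<le> udg_dist P x ?x + udg_dist P x y + udg_dist P y ?y"
      using udg_dist_triangle[of x ?x y] udg_dist_triangle[of ?x ?y y]
        udg_dist_triangle[of ?x x ?y] udg_dist_triangle[of x y ?y]
        udg_dist_sym[of x ?x] udg_dist_sym[of y ?y] xy P by simp_all
    \<comment> \<open>Moving both points to their centres changes the distance by less than
      \<open>resolution i\<close>, hence by less than one unit
      \<open>resolution i / \<epsilon>\<close>.\<close>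
    then have "2 * (resolution i / \<epsilon>) \<le> udg_dist P ?x ?y \<and> udg_dist P ?x ?y \<le> 16 * (resolution i / \<epsilon>)"
      using near i resolution_le(2)[of i] by linarith
    then have "{voronoi_cell P (c i) ?x, voronoi_cell P (c i) ?y}
        \<in> level_pairs P \<epsilon> (resolution i) (N i) (c i)"
      using near unfolding level_pairs_def by auto
    moreover have "x \<in> voronoi_cell P (c i) ?x" "y \<in> voronoi_cell P (c i) ?y"
      using xy by (auto simp: voronoi_cell_def)
    ultimately show ?thesis
      using i(1) unfolding pairs_def by blast
  qed
qed

lemma wspd_pairs: "wspd (udg_dist P) (1 / \<epsilon>) P pairs"
proof (rule wspdI[OF finite_P pair_decomposition_pairs udg_dist_sym])
  fix A B a a' x y
  assume AB: "{A, B} \<in> pairs" and pts: "a \<in> A" "a' \<in> A" "x \<in> A" "y \<in> B"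
  have P: "a \<in> P" "a' \<in> P" "x \<in> P" "y \<in> P"
    using pts pair_decompositionD[OF pair_decomposition_pairs AB] by auto
  consider "{A, B} \<in> short_pairs W0"
    | i where "i \<in> levels P" "{A, B} \<in> level_pairs P \<epsilon> (resolution i) (N i) (c i)"
    using AB unfolding pairs_def by blast
  then have "udg_dist P a a' \<le> \<epsilon> * udg_dist P x y"
  proof cases
    case 1
    then have W: "{A, B} \<in> W0" and diam: "diam_wrt dist A \<le> 1"
      by (auto simp: short_pairs_def)
    have "finite A"
      using pair_decompositionD(1)[OF W0_decomposition W] finite_P by (rule finite_subset)
    then have aa: "dist a a' \<le> diam_wrt dist A"
      using pts le_diam_wrt[of A a a' dist] by simp
    \<comment> \<open>Diameter at most 1 makes \<open>A\<close> a clique, so the Euclidean bound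
      transfers to the graph metric.\<close>
    then have "udg_dist P a a' \<le> diam_wrt dist A"
      using diam P by (simp add: udg_dist_eq_dist)
    also have "\<dots> \<le> 1 / (64 / \<epsilon>) * dist x y"
      using wspdD(1)[OF finite_P W0 _ W pts(3,4)] eps by simp
    also have "\<dots> \<le> \<epsilon> * udg_dist P x y"
      using eps dist_le_udg_dist[OF P(3,4)] by (intro mult_mono) auto
    finally show ?thesis .
  next
    case 2
    then obtain p q where pq: "A = voronoi_cell P (c i) p" "B = voronoi_cell P (c i) q"
      "p \<in> N i" "q \<in> N i"
      "2 * (resolution i / \<epsilon>) \<le> udg_dist P p q \<or> 2 * (resolution i / \<epsilon>) \<le> udg_dist P q p"
      using level_pairE by metis
    have pqP: "p \<in> P" "q \<in> P"
      using pq N_subset[OF 2(1)] by auto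
    have far: "2 * (resolution i / \<epsilon>) \<le> udg_dist P p q"
      using pq(5) udg_dist_sym[OF pqP] by auto
    have near: "udg_dist P a p < resolution i / 2" "udg_dist P a' p < resolution i / 2"
      "udg_dist P x p < resolution i / 2" "udg_dist P y q < resolution i / 2"
      using nearest_in(2)[OF 2(1) P(1)] nearest_in(2)[OF 2(1) P(2)]
        nearest_in(2)[OF 2(1) P(3)] nearest_in(2)[OF 2(1) P(4)] pts
      by (simp_all add: pq voronoi_cell_def)
    have "udg_dist P a a' \<le> resolution i"
      using udg_dist_triangle[OF P(1) pqP(1) P(2)] udg_dist_sym[OF P(2) pqP(1)] near by linarith
    also have "\<dots> = \<epsilon> * (resolution i / \<epsilon>)"
      using eps by simp
    also have "\<dots> \<le> \<epsilon> * udg_dist P x y"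
    proof (rule mult_left_mono)
      have "udg_dist P p q \<le> udg_dist P x p + udg_dist P x y + udg_dist P y q"
        using udg_dist_triangle[OF pqP(1) P(3) pqP(2)] udg_dist_triangle[OF P(3,4) pqP(2)]
          udg_dist_sym[OF P(3) pqP(1)] by linarith
      \<comment> \<open>Two cell radii cost less than \<open>resolution i\<close>, that is, at most
        one of the two units \<open>resolution i / \<epsilon>\<close> between the centres.\<close>
      then show "resolution i / \<epsilon> \<le> udg_dist P x y"
        using far near resolution_le(2)[of i] by linarith
    qed (use eps in simp)
    finally show ?thesis .
  qed
  then show "udg_dist P a a' \<le> 1 / (1 / \<epsilon>) * udg_dist P x y"
    by simp
qed

section \<open>The size of the output\<close>

text \<open>Disjoint nonempty parts require two points. This case matters because the claimed bound
  is 0 for at most one point.\<close>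

lemma pairs_eq_empty:
  assumes "card P \<le> 1"
  shows "pairs = {}"
proof (rule ccontr)
  assume "pairs \<noteq> {}"
  then obtain e where "e \<in> pairs"
    by blast
  then obtain A B where AB: "A \<subseteq> P" "B \<subseteq> P" "A \<noteq> {}" "B \<noteq> {}" "A \<inter> B = {}"
    using pair_decomposition_pairs[unfolded pair_decomposition_def, THEN conjunct1, rule_format, of e]
    by blast
  then obtain a b where "a \<in> P" "b \<in> P" "a \<noteq> b"
    by blast
  then show False
    using assms card_le_Suc0_iff_eq[OF finite_P] by auto
qed

text \<open>The number of levels is 1 plus the rounded-up logarithm, at most 2 plus the logarithm,
  which is itself at least 1.\<close>

lemma card_levels:
  assumes "2 \<le> card P"
  shows "real (card (levels P)) \<le> 3 * log 2 (real (card P))"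
proof -
  have "1 \<le> log 2 (real (card P))"
    using assms by simp
  then show ?thesis
    unfolding levels_def by simp linarith
qed

text \<open>The linear bound on the short pairs is absorbed because the logarithm is at least 1. The
  constant 2116800 is 3 * 705600, and the absolute value covers an arbitrary real
  \<open>K\<close>.\<close>

lemma card_pairs:
  assumes K: "real (card W0) \<le> K * real (card P) / \<epsilon>\<^sup>2"
  shows "real (card pairs) \<le> (\<bar>K\<bar> + 2116800) * (real (card P) * log 2 (real (card P)) / \<epsilon>\<^sup>2)"
proof (cases "2 \<le> card P")
  case False
  then have "real (card P) * log 2 (real (card P)) = 0"
    by (auto simp: not_le less_2_cases_iff)
  moreover have "pairs = {}"
    using pairs_eq_empty False by simp
  ultimately show ?thesis
    by (simp only:) simp
next
  case True
  let ?n = "real (card P)"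
  let ?lev = "\<lambda>i. level_pairs P \<epsilon> (resolution i) (N i) (c i)"
  have log: "1 \<le> log 2 ?n"
    using True by simp
  \<comment> \<open>Monotonicity of \<open>card\<close> needs this, since an infinite set has
    cardinality 0.\<close>
  have "finite W0"
  proof (rule finite_subset)
    show "W0 \<subseteq> Pow (Pow P)"
    proof
      fix e assume "e \<in> W0"
      then obtain A B where "e = {A, B}" "A \<subseteq> P" "B \<subseteq> P"
        using W0_decomposition[unfolded pair_decomposition_def, THEN conjunct1, rule_format, of e]
        by blast
      then show "e \<in> Pow (Pow P)"
        by simp
    qed
  qed (use finite_P in simp)
  then have "card (short_pairs W0) \<le> card W0"
    by (intro card_mono) (auto simp: short_pairs_def)
  then have "real (card (short_pairs W0)) \<le> K * (?n / \<epsilon>\<^sup>2)"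
    using K by simp
  also have "\<dots> \<le> \<bar>K\<bar> * (?n / \<epsilon>\<^sup>2)"
    by (intro mult_right_mono) auto
  also have "\<dots> \<le> \<bar>K\<bar> * (?n / \<epsilon>\<^sup>2 * log 2 ?n)"
    using mult_left_mono[OF log, of "?n / \<epsilon>\<^sup>2"] by (intro mult_left_mono) auto
  finally have short: "real (card (short_pairs W0)) \<le> \<bar>K\<bar> * (?n / \<epsilon>\<^sup>2 * log 2 ?n)" .
  have "card (\<Union>i\<in>levels P. ?lev i) \<le> (\<Sum>i\<in>levels P. card (?lev i))"
    by (intro card_UN_le) (simp add: levels_def)
  then have "real (card (\<Union>i\<in>levels P. ?lev i)) \<le> (\<Sum>i\<in>levels P. real (card (?lev i)))"
    by (simp flip: of_nat_sum)
  also have "\<dots> \<le> real (card (levels P)) * (705600 * (?n / \<epsilon>\<^sup>2))"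
    using eps packing by (intro sum_bounded_above card_level_pairs) (auto simp: levels_def)
  also have "\<dots> \<le> 3 * log 2 ?n * (705600 * (?n / \<epsilon>\<^sup>2))"
    by (intro mult_right_mono card_levels[OF True]) auto
  finally have "real (card (\<Union>i\<in>levels P. ?lev i)) \<le> 2116800 * (?n / \<epsilon>\<^sup>2 * log 2 ?n)"
    by (simp add: mult_ac)
  moreover have "card pairs \<le> card (short_pairs W0) + card (\<Union>i\<in>levels P. ?lev i)"
    unfolding pairs_def by (rule card_Un_le)
  ultimately show ?thesis
    using short by (simp add: algebra_simps)
qed

end

text \<open>\<open>C\<close> is chosen right after \<open>K\<close>, so it is absolute once the
  constant of Callahan and Kosaraju is fixed.\<close>

theorem theorem3p8:
  shows "\<forall>K::real. \<exists>C::real. C > 0 \<and>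
    (\<forall>(P :: (real^2) set) (\<epsilon> :: real) W.
       finite P \<longrightarrow> Digraph_Component.connected (with_proj (udg P)) \<longrightarrow> 0 < \<epsilon> \<longrightarrow> \<epsilon> < 1 \<longrightarrow>
       construction_output K P \<epsilon> W \<longrightarrow>
         wspd (udg_dist P) (1 / \<epsilon>) P W \<and>
         real (card W) \<le> C * (real (card P) * log 2 (real (card P)) / \<epsilon>\<^sup>2))"
proof (intro allI exI conjI impI)
  fix K :: real
  show "0 < \<bar>K\<bar> + 2116800"
    by simp
  fix P :: "(real^2) set" and \<epsilon> :: real and W
  assume P: "finite P" "Digraph_Component.connected (with_proj (udg P))" and eps: "0 < \<epsilon>" "\<epsilon> < 1"
    and "construction_output K P \<epsilon> W"
  then obtain W0 N c where W0: "wspd dist (64 / \<epsilon>) P W0" and card_W0: "real (card W0) \<le> K * real (card P) / \<epsilon>\<^sup>2"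
    and lev: "\<forall>i\<in>levels P. packing (udg_dist P) (resolution i / 2) P (N i) \<and>
      nearest_assignment (udg_dist P) P (N i) (c i)"
    and W: "W = short_pairs W0 \<union> (\<Union>i\<in>levels P. level_pairs P \<epsilon> (resolution i) (N i) (c i))"
    unfolding construction_output_def by blast
  interpret udg_construction P \<epsilon> W0 N c
    using P eps W0 lev by unfold_locales auto
  have W: "W = pairs"
    by (simp add: W pairs_def)
  show "wspd (udg_dist P) (1 / \<epsilon>) P W"
    unfolding W by (rule wspd_pairs)
  show "real (card W) \<le> (\<bar>K\<bar> + 2116800) * (real (card P) * log 2 (real (card P)) / \<epsilon>\<^sup>2)"
    unfolding W by (rule card_pairs[OF card_W0])
qed

end
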